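(* Let $S$ be a non-empty set endowed with two operations $+$ and $\circ$ such that $(S,+)$ and $(S,\circ)$ are semigroups. Then $(S,+,\circ)$ is a weak brace if and only if $(S,+,\circ)$ is an inverse semi-brace such that the following hold: 1. $(S,+)$ is an inverse semigroup; 2. $a\circ(a^-+b)=-a+a\circ b$ for all $a,b\in S$.
   Context: A semigroup is inverse if each element $a$ has a unique inverse, i.e. a unique $x$ with $axa=a$ and $xax=x$. When the respective structures are inverse semigroups, $-a$ denotes the inverse of $a$ in $(S,+)$ and $a^-$ the inverse of $a$ in $(S,\circ)$; $\circ$ has higher precedence than $+$. A weak (left) brace is a non-empty set $S$ with two operations such that $(S,+)$ and $(S,\circ)$ are both inverse semigroups (not necessarily commutative) and, for all $a,b,c\in S$, $a\circ(b+c)=a\circ b-a+a\circ c$ and $a\circ a^-=-a+a$. A (left) inverse semi-brace is a non-empty set $S$ with two operations such that $(S,+)$ is a semigroup (not necessarily commutative), $(S,\circ)$ is an inverse semigroup, and $a\circ(b+c)=a\circ b+a\circ(a^-+c)$ for all $a,b,c\in S$. *)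

theory Defs
  imports Main
begin

(* The class and locale semigroup of HOL act on a whole type; the structures
   here live on an arbitrary carrier set S, and an operation is constrained only there. *)

definition semigroup_on :: "'a set \<Rightarrow> ('a \<Rightarrow> 'a \<Rightarrow> 'a) \<Rightarrow> bool" where
  "semigroup_on S f \<longleftrightarrow>
     (\<forall>a\<in>S. \<forall>b\<in>S. f a b \<in> S) \<and>
     (\<forall>a\<in>S. \<forall>b\<in>S. \<forall>c\<in>S. f (f a b) c = f a (f b c))"

definition is_inverse_on :: "'a set \<Rightarrow> ('a \<Rightarrow> 'a \<Rightarrow> 'a) \<Rightarrow> 'a \<Rightarrow> 'a \<Rightarrow> bool" where
  "is_inverse_on S f a x \<longleftrightarrow> x \<in> S \<and> f (f a x) a = a \<and> f (f x a) x = x"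

definition inverse_semigroup_on :: "'a set \<Rightarrow> ('a \<Rightarrow> 'a \<Rightarrow> 'a) \<Rightarrow> bool" where
  "inverse_semigroup_on S f \<longleftrightarrow>
     semigroup_on S f \<and> (\<forall>a\<in>S. \<exists>!x. is_inverse_on S f a x)"

(* Meaningful only for a in S with inverse_semigroup_on S f. *)
definition inv_on :: "'a set \<Rightarrow> ('a \<Rightarrow> 'a \<Rightarrow> 'a) \<Rightarrow> 'a \<Rightarrow> 'a" where
  "inv_on S f a = (THE x. is_inverse_on S f a x)"

definition weak_brace ::
    "'a set \<Rightarrow> ('a \<Rightarrow> 'a \<Rightarrow> 'a) \<Rightarrow> ('a \<Rightarrow> 'a \<Rightarrow> 'a) \<Rightarrow> bool" where
  "weak_brace S add circ \<longleftrightarrow>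
     S \<noteq> {} \<and> inverse_semigroup_on S add \<and> inverse_semigroup_on S circ \<and>
     (\<forall>a\<in>S. \<forall>b\<in>S. \<forall>c\<in>S.
        circ a (add b c) = add (add (circ a b) (inv_on S add a)) (circ a c)) \<and>
     (\<forall>a\<in>S. circ a (inv_on S circ a) = add (inv_on S add a) a)"

definition inverse_semi_brace ::
    "'a set \<Rightarrow> ('a \<Rightarrow> 'a \<Rightarrow> 'a) \<Rightarrow> ('a \<Rightarrow> 'a \<Rightarrow> 'a) \<Rightarrow> bool" where
  "inverse_semi_brace S add circ \<longleftrightarrow>
     S \<noteq> {} \<and> semigroup_on S add \<and> inverse_semigroup_on S circ \<and>
     (\<forall>a\<in>S. \<forall>b\<in>S. \<forall>c\<in>S.
        circ a (add b c) = add (circ a b) (circ a (add (inv_on S circ a) c)))"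

end

theory Submission
  imports Defs
begin

text \<open>
  Write \<open>e = a \<circ> a\<^sup>-\<close> and \<open>p = -a + a\<close>.  Given the weak brace axiom \<open>e = p\<close>, putting
  \<open>a\<^sup>-\<close> for the first summand in \<open>a \<circ> (b + c) = a \<circ> b - a + a \<circ> c\<close> gives
  \<open>a \<circ> (a\<^sup>- + c) = (-a + a) - a + a \<circ> c = -a + a \<circ> c\<close>, which is condition 2.  Under this condition
  the two distributive laws are the same law.

  The substance is the recovery of \<open>e = p\<close> from condition 2 and the distributive law.
  These show first that every idempotent of \<open>\<circ>\<close> is an idempotent of \<open>+\<close>
  (\<open>circ_idempotent_neg_add\<close>), and then that \<open>p = e + p\<close> and \<open>e = p + e\<close>.  Two idempotents
  so related are inverse to each other, and uniqueness of inverses identifies them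
  (\<open>idempotents_eqI\<close>).
\<close>

lemma semigroup_on_closed:
  "semigroup_on S f \<Longrightarrow> a \<in> S \<Longrightarrow> b \<in> S \<Longrightarrow> f a b \<in> S"
  by (simp add: semigroup_on_def)

lemma semigroup_on_assoc:
  "semigroup_on S f \<Longrightarrow> a \<in> S \<Longrightarrow> b \<in> S \<Longrightarrow> c \<in> S \<Longrightarrow> f (f a b) c = f a (f b c)"
  by (simp add: semigroup_on_def)

lemma inverse_semigroup_on_semigroup:
  "inverse_semigroup_on S f \<Longrightarrow> semigroup_on S f"
  by (simp add: inverse_semigroup_on_def)

lemma is_inverse_on_inv_on:
  assumes "inverse_semigroup_on S f" and "a \<in> S"
  shows "is_inverse_on S f a (inv_on S f a)"
proof -
  have "\<exists>!x. is_inverse_on S f a x"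
    using assms by (simp add: inverse_semigroup_on_def)
  then show ?thesis
    unfolding inv_on_def by (rule theI')
qed

lemma inv_on_eqI:
  assumes "inverse_semigroup_on S f" and "a \<in> S" and "is_inverse_on S f a x"
  shows "inv_on S f a = x"
  using assms is_inverse_on_inv_on[OF assms(1,2)] by (auto simp: inverse_semigroup_on_def)

lemma
  assumes "inverse_semigroup_on S f" and "a \<in> S"
  shows inv_on_closed: "inv_on S f a \<in> S"
    and mult_inv_on_mult: "f (f a (inv_on S f a)) a = a"
    and inv_on_mult_inv_on: "f (f (inv_on S f a) a) (inv_on S f a) = inv_on S f a"
  using is_inverse_on_inv_on[OF assms] by (simp_all add: is_inverse_on_def)

lemma inv_on_inv_on:
  assumes "inverse_semigroup_on S f" and "a \<in> S"
  shows "inv_on S f (inv_on S f a) = a"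
  using assms by (intro inv_on_eqI)
    (simp_all add: is_inverse_on_def inv_on_closed mult_inv_on_mult inv_on_mult_inv_on)

lemma inv_on_idempotent:
  assumes "inverse_semigroup_on S f" and "e \<in> S" and "f e e = e"
  shows "inv_on S f e = e"
  using assms by (intro inv_on_eqI) (simp_all add: is_inverse_on_def)

text \<open>
  The hypotheses say that \<open>e\<close> and \<open>p\<close> generate the same right ideal.  Since
  \<open>p e p = e p = p\<close> and \<open>e p e = p e = e\<close>, both \<open>e\<close> and \<open>p\<close> are inverses of \<open>p\<close>.
\<close>

lemma idempotents_eqI:
  assumes inverse: "inverse_semigroup_on S f"
    and "e \<in> S" and "p \<in> S" and "f p p = p"
    and ep: "f e p = p" and pe: "f p e = e"
  shows "e = p"
proof -
  have "is_inverse_on S f p e"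
    using assms by (simp add: is_inverse_on_def)
  then have "inv_on S f p = e"
    using assms by (intro inv_on_eqI)
  moreover have "inv_on S f p = p"
    using assms by (intro inv_on_idempotent)
  ultimately show ?thesis by simp
qed

text \<open>
  Evaluate \<open>e \<circ> (e + e)\<close> in two ways, with \<open>e\<^sup>- = e\<close>: condition 2 gives \<open>-e + e\<close>, the
  distributive law gives \<open>e - e + e = e\<close>.  In particular \<open>e\<close> is idempotent for \<open>+\<close>.
\<close>

lemma circ_idempotent_neg_add:
  fixes add (infixl "\<oplus>" 65) and circ (infixl "\<odot>" 70)
  assumes add: "inverse_semigroup_on S (\<oplus>)" and circ: "inverse_semigroup_on S (\<odot>)"
    and distrib: "\<And>a b c. a \<in> S \<Longrightarrow> b \<in> S \<Longrightarrow> c \<in> S \<Longrightarrow>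
      a \<odot> (b \<oplus> c) = a \<odot> b \<oplus> (inv_on S (\<oplus>) a \<oplus> a \<odot> c)"
    and shift: "\<And>a b. a \<in> S \<Longrightarrow> b \<in> S \<Longrightarrow>
      a \<odot> (inv_on S (\<odot>) a \<oplus> b) = inv_on S (\<oplus>) a \<oplus> a \<odot> b"
    and e: "e \<in> S" "e \<odot> e = e"
  shows "inv_on S (\<oplus>) e \<oplus> e = e"
proof -
  have "inv_on S (\<oplus>) e \<oplus> e = e \<odot> (e \<oplus> e)"
    using shift[of e e] e by (simp add: inv_on_idempotent[OF circ])
  also have "\<dots> = e \<oplus> (inv_on S (\<oplus>) e \<oplus> e)"
    using distrib[of e e e] e by simp
  also have "\<dots> = e"
    using e semigroup_on_assoc[OF inverse_semigroup_on_semigroup[OF add]]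
      inv_on_closed[OF add e(1)] mult_inv_on_mult[OF add e(1)] by simp
  finally show ?thesis .
qed

text \<open>
  The equation \<open>p = e + p\<close> comes from expanding \<open>a \<circ> (a\<^sup>- + a\<^sup>- \<circ> a)\<close> by both laws.
  For \<open>e = p + e\<close>, write \<open>a\<^sup>- = a\<^sup>- - a\<^sup>- + a\<^sup>-\<close>, so that condition 2 gives
  \<open>e = -a + a \<circ> (-a\<^sup>- + a\<^sup>-)\<close>; condition 2 for \<open>a\<^sup>-\<close> turns the last term into
  \<open>e \<circ> (a + e)\<close>, which is \<open>a + e\<close>.
\<close>

lemma circ_inv_eq_neg_add:
  fixes add (infixl "\<oplus>" 65) and circ (infixl "\<odot>" 70)
  assumes add: "inverse_semigroup_on S (\<oplus>)" and circ: "inverse_semigroup_on S (\<odot>)"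
    and distrib: "\<And>a b c. a \<in> S \<Longrightarrow> b \<in> S \<Longrightarrow> c \<in> S \<Longrightarrow>
      a \<odot> (b \<oplus> c) = a \<odot> b \<oplus> (inv_on S (\<oplus>) a \<oplus> a \<odot> c)"
    and shift: "\<And>a b. a \<in> S \<Longrightarrow> b \<in> S \<Longrightarrow>
      a \<odot> (inv_on S (\<odot>) a \<oplus> b) = inv_on S (\<oplus>) a \<oplus> a \<odot> b"
    and a: "a \<in> S"
  shows "a \<odot> inv_on S (\<odot>) a = inv_on S (\<oplus>) a \<oplus> a"
proof -
  note add_closed = semigroup_on_closed[OF inverse_semigroup_on_semigroup[OF add]]
    and circ_closed = semigroup_on_closed[OF inverse_semigroup_on_semigroup[OF circ]]
    and add_assoc = semigroup_on_assoc[OF inverse_semigroup_on_semigroup[OF add]]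
    and circ_assoc = semigroup_on_assoc[OF inverse_semigroup_on_semigroup[OF circ]]
  let ?neg = "inv_on S (\<oplus>)"
  define a' where "a' = inv_on S (\<odot>) a"
  define e where "e = a \<odot> a'"
  define p where "p = ?neg a \<oplus> a"
  have a': "a' \<in> S" "inv_on S (\<odot>) a' = a" "a' \<odot> a \<odot> a' = a'" and ea: "e \<odot> a = a"
    using a circ unfolding a'_def e_def
    by (simp_all add: inv_on_closed inv_on_inv_on inv_on_mult_inv_on mult_inv_on_mult)
  have neg: "?neg a \<in> S" "?neg a' \<in> S"
    using a a' add by (simp_all add: inv_on_closed)
  have in_S: "e \<in> S" "p \<in> S"
    unfolding e_def p_def using a a' neg by (simp_all add: add_closed circ_closed)
  have a'e: "a' \<odot> e = a'"
    using a a' by (simp add: e_def circ_assoc)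
  have ee: "e \<odot> e = e"
    using a a' ea in_S by (simp add: e_def flip: circ_assoc)
  have neg_e: "?neg e \<oplus> e = e"
    by (rule circ_idempotent_neg_add[OF add circ _ _ in_S(1) ee]) (rule distrib shift; assumption)+
  have "p \<oplus> p = p"
    using a neg inv_on_mult_inv_on[OF add a] by (simp add: p_def add_closed flip: add_assoc)
  moreover have "e \<oplus> p = p"
  proof -
    have "a \<odot> (a' \<odot> a) = a"
      using a a' ea by (simp add: e_def circ_assoc)
    then show ?thesis
      using distrib[of a a' "a' \<odot> a"] shift[of a "a' \<odot> a"] a a'
      by (simp add: e_def p_def circ_closed flip: a'_def)
  qed
  moreover have "p \<oplus> e = e"
  proof -
    have "a \<odot> (?neg a' \<oplus> a') = a \<odot> (a' \<odot> (a \<oplus> e))"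
      using shift[of a' e] a' a'e in_S by simp
    also have "\<dots> = e \<odot> (a \<oplus> e)"
      using a a' in_S by (simp add: e_def circ_assoc add_closed)
    also have "\<dots> = a \<oplus> e"
      using distrib[of e a e] a in_S ea ee neg_e by simp
    finally have key: "a \<odot> (?neg a' \<oplus> a') = a \<oplus> e" .
    have "e = a \<odot> (a' \<oplus> (?neg a' \<oplus> a'))"
      using a' neg mult_inv_on_mult[OF add a'(1)] by (simp add: e_def add_assoc)
    also have "\<dots> = ?neg a \<oplus> (a \<oplus> e)"
      using shift[of a "?neg a' \<oplus> a'"] a a' neg key by (simp add: add_closed flip: a'_def)
    also have "\<dots> = p \<oplus> e"
      using a neg in_S by (simp add: p_def add_assoc)
    finally show ?thesis by simp
  qed
  ultimately have "e = p"
    by (rule idempotents_eqI[OF add in_S])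
  then show ?thesis
    by (simp add: e_def p_def a'_def)
qed

lemma weak_brace_shift:
  fixes add (infixl "\<oplus>" 65) and circ (infixl "\<odot>" 70)
  assumes brace: "weak_brace S (\<oplus>) (\<odot>)" and "a \<in> S" and "b \<in> S"
  shows "a \<odot> (inv_on S (\<odot>) a \<oplus> b) = inv_on S (\<oplus>) a \<oplus> a \<odot> b"
proof -
  have add: "inverse_semigroup_on S (\<oplus>)" and circ: "inverse_semigroup_on S (\<odot>)"
    using brace by (simp_all add: weak_brace_def)
  have "a \<odot> (inv_on S (\<odot>) a \<oplus> b) =
      a \<odot> inv_on S (\<odot>) a \<oplus> inv_on S (\<oplus>) a \<oplus> a \<odot> b"
    using assms inv_on_closed[OF circ] by (simp add: weak_brace_def)
  also have "\<dots> = inv_on S (\<oplus>) a \<oplus> a \<oplus> inv_on S (\<oplus>) a \<oplus> a \<odot> b"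
    using assms by (simp add: weak_brace_def)
  also have "\<dots> = inv_on S (\<oplus>) a \<oplus> a \<odot> b"
    using inv_on_mult_inv_on[OF add \<open>a \<in> S\<close>] by simp
  finally show ?thesis .
qed

theorem proposition20:
  fixes S :: "'a set" and add circ :: "'a \<Rightarrow> 'a \<Rightarrow> 'a"
  assumes "S \<noteq> {}" and "semigroup_on S add" and "semigroup_on S circ"
  shows "weak_brace S add circ \<longleftrightarrow>
    inverse_semi_brace S add circ \<and>
    inverse_semigroup_on S add \<and>
    (\<forall>a\<in>S. \<forall>b\<in>S.
      circ a (add (inv_on S circ a) b) = add (inv_on S add a) (circ a b))"
    (is "?weak \<longleftrightarrow> ?semi \<and> ?inverse \<and> ?shift")
proof -
  have assoc: "add (add (circ a b) (inv_on S add a)) (circ a c) =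
      add (circ a b) (add (inv_on S add a) (circ a c))"
    if "?inverse" "a \<in> S" "b \<in> S" "c \<in> S" for a b c
    using that assms
    by (simp add: semigroup_on_assoc semigroup_on_closed inv_on_closed)
  show ?thesis
  proof
    assume weak: ?weak
    then have inverse: ?inverse
      by (simp add: weak_brace_def)
    have shift: ?shift
      using weak_brace_shift[OF weak] by blast
    have circ: "inverse_semigroup_on S circ"
      using weak by (simp add: weak_brace_def)
    have "circ a (add b c) = add (circ a b) (circ a (add (inv_on S circ a) c))"
      if abc: "a \<in> S" "b \<in> S" "c \<in> S" for a b c
    proof -
      have "circ a (add b c) = add (add (circ a b) (inv_on S add a)) (circ a c)"
        using weak abc unfolding weak_brace_def by blast
      also have "\<dots> = add (circ a b) (add (inv_on S add a) (circ a c))"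
        using assoc[OF inverse abc] .
      also have "\<dots> = add (circ a b) (circ a (add (inv_on S circ a) c))"
        by (rule arg_cong[OF weak_brace_shift[OF weak abc(1,3), symmetric]])
      finally show ?thesis .
    qed
    with assms circ have ?semi
      unfolding inverse_semi_brace_def by (intro conjI ballI)
    with inverse shift show "?semi \<and> ?inverse \<and> ?shift"
      by blast
  next
    assume "?semi \<and> ?inverse \<and> ?shift"
    then have semi: ?semi and inverse: ?inverse and shift: ?shift
      by blast+
    have circ: "inverse_semigroup_on S circ"
      using semi by (simp add: inverse_semi_brace_def)
    have distrib: "circ a (add b c) = add (circ a b) (add (inv_on S add a) (circ a c))"
      if "a \<in> S" "b \<in> S" "c \<in> S" for a b c
      using semi shift that by (simp add: inverse_semi_brace_def)
    have "circ a (inv_on S circ a) = add (inv_on S add a) a" if "a \<in> S" for a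
      by (rule circ_inv_eq_neg_add[OF inverse circ _ _ that])
        (rule distrib shift[rule_format]; assumption)+
    moreover have "circ a (add b c) = add (add (circ a b) (inv_on S add a)) (circ a c)"
      if "a \<in> S" "b \<in> S" "c \<in> S" for a b c
      using distrib[OF that] assoc[OF inverse that, symmetric] by (rule trans)
    ultimately show ?weak
      unfolding weak_brace_def using assms inverse circ by (intro conjI ballI)
  qed
qed

end
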